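(* Let $\Gamma < SL_n(\mathbb{Z})$ be a subgroup of finite index. Then the standard $\Gamma$-action on the torus $\mathbb{T}^n=\mathbb{R}^n/\mathbb{Z}^n$ (by linear automorphisms) is $C^1$ OE rigid.
   Context: All actions are taken to be faithful. Two actions $(X',\Gamma')$ and $(X,\Gamma)$ are orbit equivalent if there is a homeomorphism $f:X'\to X$ which maps the orbit relation of $\Gamma'$ to the orbit relation of $\Gamma$ (that is, $x,y$ lie in the same $\Gamma'$-orbit if and only if $f(x),f(y)$ lie in the same $\Gamma$-orbit); $f$ is called an orbit equivalence. An orbit equivalence $f$ is equivariant if there is a group isomorphism $\varphi:\Gamma'\to\Gamma$ with $f(\gamma' x)=\varphi(\gamma')f(x)$ for all $\gamma'\in\Gamma'$ and $x\in X'$. A smooth action of $\Gamma$ on a smooth manifold $X$ is $C^k$ OE rigid if, for every action of a group $\Gamma'$ by $C^k$ diffeomorphisms on a smooth manifold $X'$, every orbit equivalence $f$ from $(X',\Gamma')$ to $(X,\Gamma)$ which is a $C^k$ diffeomorphism is equivariant. *)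

theory Defs
  imports "HOL-Analysis.Analysis" "HOL-Algebra.Group_Action" "HOL-Library.Extended_Nat"
begin

section \<open>Maps of class $C^k$ between open subsets of Euclidean spaces\<close>

text \<open>These notions are meant for open sets \<open>S\<close>. A map is of class $C^{k+1}$ if it is
  differentiable and all its directional derivatives are of class $C^k$.\<close>

primrec nat_Ck_on ::
  "nat \<Rightarrow> ('a::euclidean_space \<Rightarrow> 'b::euclidean_space) \<Rightarrow> 'a set \<Rightarrow> bool" where
  "nat_Ck_on 0 f S \<longleftrightarrow> continuous_on S f"
| "nat_Ck_on (Suc k) f S \<longleftrightarrow>
     (\<forall>x\<in>S. f differentiable (at x)) \<and>
     (\<forall>v. nat_Ck_on k (\<lambda>x. frechet_derivative f (at x) v) S)"

definition Ck_on ::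
  "enat \<Rightarrow> ('a::euclidean_space \<Rightarrow> 'b::euclidean_space) \<Rightarrow> 'a set \<Rightarrow> bool" where
  "Ck_on k f S \<longleftrightarrow> (\<forall>i::nat. enat i \<le> k \<longrightarrow> nat_Ck_on i f S)"


section \<open>Smooth manifolds\<close>

text \<open>A chart \<open>(U, \<phi>)\<close> is a homeomorphism \<open>\<phi>\<close> from the open set \<open>U\<close> onto an open subset of the
  Euclidean space \<^typ>\<open>'m\<close>. Atlases need not be maximal; only the values of \<open>\<phi>\<close> on \<open>U\<close> matter.\<close>

record ('a, 'm) manifold =
  mtop :: "'a topology"
  atlas :: "('a set \<times> ('a \<Rightarrow> 'm)) set"

definition smooth_manifold :: "('a, 'm::euclidean_space) manifold \<Rightarrow> bool" where
  "smooth_manifold X \<longleftrightarrow>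
     Hausdorff_space (mtop X) \<and> second_countable (mtop X) \<and>
     (\<Union>(U, \<phi>)\<in>atlas X. U) = topspace (mtop X) \<and>
     (\<forall>(U, \<phi>)\<in>atlas X. openin (mtop X) U \<and> open (\<phi> ` U) \<and>
        homeomorphic_map (subtopology (mtop X) U) (top_of_set (\<phi> ` U)) \<phi>) \<and>
     (\<forall>(U, \<phi>)\<in>atlas X. \<forall>(V, \<psi>)\<in>atlas X.
        Ck_on \<infinity> (\<psi> \<circ> inv_into U \<phi>) (\<phi> ` (U \<inter> V)))"

definition Ck_map :: "enat \<Rightarrow> ('a, 'm::euclidean_space) manifold \<Rightarrow>
    ('b, 'l::euclidean_space) manifold \<Rightarrow> ('a \<Rightarrow> 'b) \<Rightarrow> bool" where
  "Ck_map k X Y f \<longleftrightarrow>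
     continuous_map (mtop X) (mtop Y) f \<and>
     (\<forall>(U, \<phi>)\<in>atlas X. \<forall>(V, \<psi>)\<in>atlas Y.
        Ck_on k (\<psi> \<circ> f \<circ> inv_into U \<phi>) (\<phi> ` (U \<inter> f -` V)))"

definition Ck_diffeo :: "enat \<Rightarrow> ('a, 'm::euclidean_space) manifold \<Rightarrow>
    ('b, 'l::euclidean_space) manifold \<Rightarrow> ('a \<Rightarrow> 'b) \<Rightarrow> bool" where
  "Ck_diffeo k X Y f \<longleftrightarrow>
     bij_betw f (topspace (mtop X)) (topspace (mtop Y)) \<and>
     Ck_map k X Y f \<and> Ck_map k Y X (inv_into (topspace (mtop X)) f)"


section \<open>Actions and orbit equivalence\<close>

definition Ck_action :: "enat \<Rightarrow> ('a, 'm::euclidean_space) manifold \<Rightarrow>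
    'g monoid \<Rightarrow> ('g \<Rightarrow> 'a \<Rightarrow> 'a) \<Rightarrow> bool" where
  "Ck_action k X G \<alpha> \<longleftrightarrow>
     smooth_manifold X \<and> faithful_action G (topspace (mtop X)) \<alpha> \<and>
     (\<forall>g\<in>carrier G. Ck_diffeo k X X (\<alpha> g))"

definition orbit_equivalence :: "'b topology \<Rightarrow> 'h monoid \<Rightarrow> ('h \<Rightarrow> 'b \<Rightarrow> 'b) \<Rightarrow>
    'a topology \<Rightarrow> 'g monoid \<Rightarrow> ('g \<Rightarrow> 'a \<Rightarrow> 'a) \<Rightarrow> ('b \<Rightarrow> 'a) \<Rightarrow> bool" where
  "orbit_equivalence X' G' \<alpha>' X G \<alpha> f \<longleftrightarrow>
     homeomorphic_map X' X f \<and>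
     (\<forall>x\<in>topspace X'. \<forall>y\<in>topspace X'.
        y \<in> orbit G' \<alpha>' x \<longleftrightarrow> f y \<in> orbit G \<alpha> (f x))"

definition equivariant :: "'b set \<Rightarrow> 'h monoid \<Rightarrow> ('h \<Rightarrow> 'b \<Rightarrow> 'b) \<Rightarrow>
    'g monoid \<Rightarrow> ('g \<Rightarrow> 'a \<Rightarrow> 'a) \<Rightarrow> ('b \<Rightarrow> 'a) \<Rightarrow> bool" where
  "equivariant E' G' \<alpha>' G \<alpha> f \<longleftrightarrow>
     (\<exists>\<theta>\<in>iso G' G. \<forall>g\<in>carrier G'. \<forall>x\<in>E'. f (\<alpha>' g x) = \<alpha> (\<theta> g) (f x))"

text \<open>The type arguments are the type of points and the model space of the manifolds $X'$, and
  the type of elements of the groups $\Gamma'$. HOL cannot quantify over types inside a formula, so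
  rigidity is the assertion of this predicate for arbitrary (free) type variables.\<close>

definition Ck_OE_rigid :: "'b itself \<Rightarrow> 'l::euclidean_space itself \<Rightarrow> 'h itself \<Rightarrow> enat \<Rightarrow>
    ('a, 'm::euclidean_space) manifold \<Rightarrow> 'g monoid \<Rightarrow> ('g \<Rightarrow> 'a \<Rightarrow> 'a) \<Rightarrow> bool" where
  "Ck_OE_rigid _ _ _ k X G \<alpha> \<longleftrightarrow>
     Ck_action \<infinity> X G \<alpha> \<and>
     (\<forall>(X' :: ('b, 'l) manifold) (G' :: 'h monoid) \<alpha>' f.
        Ck_action k X' G' \<alpha>' \<longrightarrow>
        orbit_equivalence (mtop X') G' \<alpha>' (mtop X) G \<alpha> f \<longrightarrow>
        Ck_diffeo k X' X f \<longrightarrow>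
        equivariant (topspace (mtop X')) G' \<alpha>' G \<alpha> f)"


section \<open>The torus and the standard action\<close>

definition SL_int :: "(int ^ 'n ^ 'n) monoid" where
  "SL_int = \<lparr>carrier = {A. det A = 1}, mult = (**), one = mat 1\<rparr>"

definition int_lattice :: "(real ^ 'n) set" where
  "int_lattice = {z. \<forall>i. z $ i \<in> \<int>}"

text \<open>Points of the torus are the cosets of the integer lattice.\<close>

definition torus_proj :: "real ^ 'n \<Rightarrow> (real ^ 'n) set" where
  "torus_proj x = (+) x ` int_lattice"

definition torus_topology :: "(real ^ 'n) set topology" where
  "torus_topology = topology (\<lambda>U. U \<subseteq> range torus_proj \<and> open (torus_proj -` U))"

lemma openin_torus_topology:
  fixes U :: "(real ^ 'n) set set"
  shows
  "openin torus_topology U \<longleftrightarrow> U \<subseteq> range torus_proj \<and> open (torus_proj -` U)"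
proof -
  have "istopology (\<lambda>U. U \<subseteq> range torus_proj \<and> open (torus_proj -` U :: (real ^ 'n) set))"
    unfolding istopology_def by (auto simp: vimage_Union intro!: open_UN)
  then show ?thesis
    by (simp add: torus_topology_def topology_inverse')
qed

lemma topspace_torus_topology:
  "topspace torus_topology = range (torus_proj :: real ^ 'n \<Rightarrow> _)"
proof -
  have "torus_proj -` range torus_proj = (UNIV :: (real ^ 'n) set)"
    by auto
  then have "openin torus_topology (range (torus_proj :: real ^ 'n \<Rightarrow> _))"
    by (simp add: openin_torus_topology)
  then show ?thesis
    by (meson openin_subset openin_topspace openin_torus_topology subset_antisym)
qed

lemma quotient_map_torus_proj: "quotient_map euclidean torus_topology torus_proj"
  by (auto simp: quotient_map_def topspace_torus_topology openin_torus_topology vimage_def)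

text \<open>The charts are the inverses of the restrictions of the projection to the open sets on
  which it is injective.\<close>

definition torus :: "((real ^ 'n) set, real ^ 'n) manifold" where
  "torus = \<lparr>mtop = torus_topology,
     atlas = {(torus_proj ` W, inv_into W torus_proj) | W. open W \<and> inj_on torus_proj W}\<rparr>"

text \<open>A matrix sends the coset $x + \mathbb{Z}^n$ to its image under $A$, which is
  $Ax + \mathbb{Z}^n$ for $A$ in $SL_n(\mathbb{Z})$. As everywhere in the library's group actions,
  the maps are extensional on the acted-on set.\<close>

definition torus_action :: "int ^ 'n ^ 'n \<Rightarrow> (real ^ 'n) set \<Rightarrow> (real ^ 'n) set" where
  "torus_action A = (\<lambda>c\<in>range torus_proj. (\<lambda>x. map_matrix real_of_int A *v x) ` c)"

end

theory Submission
  imports Defs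
begin

text \<open>Transport the action of \<open>\<Gamma>'\<close> to the torus by \<open>f\<close>. A transported element \<open>h\<close> is a $C^1$ map
  which agrees at every point with some element of the countable group \<open>\<Gamma>\<close>, so by the Baire
  category theorem it is locally equal to elements of \<open>\<Gamma>\<close> on a dense open set. There the derivative
  of \<open>h\<close> is an integer matrix; as it is continuous, it is one and the same integer matrix everywhere,
  and \<open>h\<close> is an element of \<open>\<Gamma>\<close>. Thus \<open>\<Gamma>'\<close> embeds into \<open>\<Gamma>\<close>, and a point with distinct images under
  distinct elements of \<open>\<Gamma>\<close>, which exists by the Baire category theorem again, shows that the
  embedding is onto.\<close>

section \<open>Integer matrices\<close>

lemma map_matrix_of_int_mult:
  "map_matrix real_of_int (A ** B) = map_matrix real_of_int A ** map_matrix real_of_int B"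
  by (simp add: vec_eq_iff matrix_matrix_mult_def)

lemma map_matrix_of_int_one: "map_matrix real_of_int (mat 1) = mat 1"
  by (simp add: vec_eq_iff mat_def)

lemma map_matrix_of_int_eq_iff:
  "map_matrix real_of_int A = map_matrix real_of_int B \<longleftrightarrow> A = B"
  by (simp add: vec_eq_iff)

lemma det_map_matrix_of_int: "det (map_matrix real_of_int A) = real_of_int (det A)"
  by (simp add: det_def)

lemma det_in_Ints:
  fixes A :: "real ^ 'n ^ 'n"
  assumes "\<And>i j. A $ i $ j \<in> \<int>"
  shows "det A \<in> \<int>"
  unfolding det_def using assms by (intro Ints_sum Ints_mult Ints_prod) auto

text \<open>By Cramer's rule the entries of the real inverse are integer determinants.\<close>

lemma int_matrix_inverse:
  fixes A :: "int ^ 'n ^ 'n"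
  assumes "det A = 1"
  obtains B where "det B = 1" "A ** B = mat 1" "B ** A = mat 1"
proof -
  define M where "M = map_matrix real_of_int A"
  have M: "det M = 1"
    by (simp add: M_def det_map_matrix_of_int assms)
  then obtain R where R: "M ** R = mat 1" "R ** M = mat 1"
    by (metis invertible_det_nz invertible_def zero_neq_one)
  have Rint: "R $ i $ j \<in> \<int>" for i j
  proof -
    have "M *v (R *v axis j 1) = axis j 1"
      by (simp add: matrix_vector_mul_assoc R)
    then have "R *v axis j 1 = (\<chi> k. det (\<chi> i l. if l = k then axis j 1 $ i else M $ i $ l) / det M)"
      using cramer[of M] M by simp
    then have "(R *v axis j 1) $ i
        = det (\<chi> i' l. if l = i then axis j 1 $ i' else M $ i' $ l)"
      by (simp add: M)
    also have "\<dots> \<in> \<int>"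
      by (rule det_in_Ints) (simp add: axis_def M_def)
    finally show ?thesis
      by (simp add: matrix_vector_mult_basis column_def)
  qed
  \<comment> \<open>The floors are exact because the entries of \<open>R\<close> are integers;
    \<open>B\<close> is \<open>R\<close> read over the integers, and
    \<open>map_matrix_of_int_eq_iff\<close> carries the two products back.\<close>
  define B :: "int ^ 'n ^ 'n" where "B = (\<chi> i j. \<lfloor>R $ i $ j\<rfloor>)"
  have BR: "map_matrix real_of_int B = R"
    using Rint by (simp add: vec_eq_iff B_def)
  have AB: "A ** B = mat 1" "B ** A = mat 1"
    using R by (simp_all add: map_matrix_of_int_one BR M_def map_matrix_of_int_mult
        flip: map_matrix_of_int_eq_iff)
  have "det A * det B = 1"
    by (metis AB(1) det_mul det_I)
  then have "det B = 1"
    using assms by simp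
  with AB that show ?thesis by blast
qed

lemma group_SL_int: "group (SL_int :: (int ^ 'n ^ 'n) monoid)"
proof (rule groupI)
  fix A :: "int ^ 'n ^ 'n"
  assume "A \<in> carrier SL_int"
  then show "\<exists>B\<in>carrier SL_int. B \<otimes>\<^bsub>SL_int\<^esub> A = \<one>\<^bsub>SL_int\<^esub>"
    using int_matrix_inverse[of A] by (force simp: SL_int_def)
qed (auto simp: SL_int_def det_mul matrix_mul_assoc)

section \<open>$C^k$ maps\<close>

text \<open>On an open set, equality of values is equality near each point, so the derivatives agree
  there too. The induction passes from \<open>f\<close> and \<open>g\<close> to these derivatives,
  hence both are generalised.\<close>

lemma nat_Ck_on_cong:
  assumes "open S" "\<And>x. x \<in> S \<Longrightarrow> f x = g x" "nat_Ck_on k f S"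
  shows "nat_Ck_on k g S"
  using assms(2,3)
proof (induction k arbitrary: f g)
  case 0
  then show ?case by (metis continuous_on_cong nat_Ck_on.simps(1))
next
  case (Suc k)
  have der: "(g has_derivative frechet_derivative f (at x)) (at x)" if "x \<in> S" for x
  proof -
    have "(f has_derivative frechet_derivative f (at x)) (at x)"
      using Suc.prems(2) that frechet_derivative_works by auto
    then show ?thesis
      using has_derivative_transform_within_open[OF _ assms(1) that] Suc.prems(1) by blast
  qed
  have eq: "frechet_derivative f (at x) v = frechet_derivative g (at x) v" if "x \<in> S" for x v
    using frechet_derivative_at[OF der[OF that]] by simp
  have "nat_Ck_on k (\<lambda>x. frechet_derivative g (at x) v) S" for v
    by (rule Suc.IH[OF eq]) (use Suc.prems(2) in auto)
  moreover have "g differentiable at x" if "x \<in> S" for x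
    using der[OF that] by (rule differentiableI)
  ultimately show ?case
    by simp
qed

lemma nat_Ck_on_local:
  assumes "\<And>x. x \<in> S \<Longrightarrow> \<exists>N. open N \<and> x \<in> N \<and> nat_Ck_on k f N"
  shows "nat_Ck_on k f S"
  using assms
proof (induction k arbitrary: f)
  case 0
  have "isCont f x" if "x \<in> S" for x
    using 0[OF that] by (auto simp: continuous_on_eq_continuous_at)
  then show ?case
    by (simp add: continuous_at_imp_continuous_on)
next
  case (Suc k)
  show ?case
    unfolding nat_Ck_on.simps
  proof (intro conjI ballI allI)
    show "f differentiable at x" if "x \<in> S" for x
      using Suc.prems[OF that] by auto
    show "nat_Ck_on k (\<lambda>x. frechet_derivative f (at x) v) S" for v
      by (rule Suc.IH) (use Suc.prems in fastforce)
  qed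
qed

text \<open>Chart expressions built with \<open>inv_into\<close> are awkward to differentiate
  directly. This rule lets them be replaced, near each point, by an affine map or by a composition
  of two other chart expressions.\<close>

lemma Ck_on_local:
  assumes "\<And>x. x \<in> S \<Longrightarrow> \<exists>N g. open N \<and> x \<in> N \<and> Ck_on k g N \<and> (\<forall>y\<in>N. g y = f y)"
  shows "Ck_on k f S"
  unfolding Ck_on_def
proof (intro allI impI)
  fix i :: nat
  assume i: "enat i \<le> k"
  show "nat_Ck_on i f S"
  proof (rule nat_Ck_on_local)
    fix x assume "x \<in> S"
    then obtain N g where N: "open N" "x \<in> N" "Ck_on k g N" "\<forall>y\<in>N. g y = f y"
      using assms by blast
    then have "nat_Ck_on i f N"
      using nat_Ck_on_cong[of N g f i] i by (auto simp: Ck_on_def)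
    with N show "\<exists>N. open N \<and> x \<in> N \<and> nat_Ck_on i f N" by blast
  qed
qed

lemma nat_Ck_on_const: "nat_Ck_on k (\<lambda>x. c) S"
  by (induction k arbitrary: c) auto

text \<open>The derivative is \<open>L\<close> at every point, so each directional derivative is
  constant and all higher orders reduce to \<open>nat_Ck_on_const\<close>.\<close>

lemma Ck_on_affine:
  assumes "bounded_linear L"
  shows "Ck_on k (\<lambda>x. L x + c) S"
  unfolding Ck_on_def
proof (intro allI impI)
  have der: "((\<lambda>x. L x + c) has_derivative L) (at x)" for x
    using bounded_linear_imp_has_derivative[OF assms] by (auto intro!: derivative_eq_intros)
  fix i
  show "nat_Ck_on i (\<lambda>x. L x + c) S"
  proof (cases i)
    case 0
    then show ?thesis
      using linear_continuous_on[OF assms] by (simp add: continuous_on_add)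
  next
    case (Suc j)
    then show ?thesis
      using der nat_Ck_on_const frechet_derivative_at[OF der, symmetric]
      by (auto simp: differentiable_def)
  qed
qed

lemma Ck_on_1_iff:
  "Ck_on 1 f S \<longleftrightarrow> continuous_on S f \<and> (\<forall>x\<in>S. f differentiable at x) \<and>
     (\<forall>v. continuous_on S (\<lambda>x. frechet_derivative f (at x) v))"
proof -
  have "enat i \<le> 1 \<longleftrightarrow> i = 0 \<or> i = Suc 0" for i
    by (auto simp: one_enat_def)
  then show ?thesis
    by (auto simp: Ck_on_def)
qed

lemma Ck_on_1_compose:
  assumes P: "Ck_on 1 P S" and Q: "Ck_on 1 Q T" and "P ` S \<subseteq> T"
  shows "Ck_on 1 (Q \<circ> P) S"
proof -
  let ?DP = "\<lambda>x. frechet_derivative P (at x)" and ?DQ = "\<lambda>y. frechet_derivative Q (at y)"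
  have der: "((Q \<circ> P) has_derivative (?DQ (P x) \<circ> ?DP x)) (at x)" if "x \<in> S" for x
  proof (rule diff_chain_at)
    show "(P has_derivative ?DP x) (at x)"
      using P that by (simp add: Ck_on_1_iff frechet_derivative_works)
    show "(Q has_derivative ?DQ (P x)) (at (P x))"
      using Q that assms(3) by (auto simp: Ck_on_1_iff frechet_derivative_works)
  qed
  \<comment> \<open>Continuity of the derivative is only given for fixed directions, whereas here
    the direction \<open>?DP x v\<close> moves with \<open>x\<close>. Expanding it in the basis
    leaves fixed directions \<open>b\<close> with continuous coefficients.\<close>
  have expand: "?DQ (P x) (?DP x v) = (\<Sum>b\<in>Basis. (?DP x v \<bullet> b) *\<^sub>R ?DQ (P x) b)"
    if "x \<in> S" for x v
  proof -
    have lin: "linear (?DQ (P x))"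
      using Q that assms(3) by (auto simp: Ck_on_1_iff intro!: linear_frechet_derivative)
    have "?DQ (P x) (?DP x v) = ?DQ (P x) (\<Sum>b\<in>Basis. (?DP x v \<bullet> b) *\<^sub>R b)"
      by (simp add: euclidean_representation)
    also have "\<dots> = (\<Sum>b\<in>Basis. (?DP x v \<bullet> b) *\<^sub>R ?DQ (P x) b)"
      using lin by (simp add: linear_sum linear_scale)
    finally show ?thesis .
  qed
  have "continuous_on S (\<lambda>x. ?DQ (P x) b)" for b
    using continuous_on_compose2[of T "\<lambda>y. ?DQ y b" S P] P Q assms(3)
    by (auto simp: Ck_on_1_iff)
  then have "continuous_on S (\<lambda>x. \<Sum>b\<in>Basis. (?DP x v \<bullet> b) *\<^sub>R ?DQ (P x) b)" for v
    using P by (auto simp: Ck_on_1_iff intro!: continuous_intros)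
  then have "continuous_on S (\<lambda>x. ?DQ (P x) (?DP x v))" for v
    using expand by (metis (mono_tags, lifting) continuous_on_cong)
  moreover have "frechet_derivative (Q \<circ> P) (at x) v = ?DQ (P x) (?DP x v)" if "x \<in> S" for x v
    using frechet_derivative_at[OF der[OF that], symmetric] by simp
  ultimately have "continuous_on S (\<lambda>x. frechet_derivative (Q \<circ> P) (at x) v)" for v
    by (metis (mono_tags, lifting) continuous_on_cong)
  moreover have "continuous_on S (Q \<circ> P)"
    using P Q assms(3) by (metis Ck_on_1_iff continuous_on_compose continuous_on_subset)
  ultimately show ?thesis
    using der by (auto simp: Ck_on_1_iff differentiable_def)
qed

lemma Ck_on_subset:
  assumes "Ck_on k f T" "S \<subseteq> T" "open T"
  shows "Ck_on k f S"
  using assms by (intro Ck_on_local) blast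

section \<open>Charts of manifolds and composition of C^1 maps\<close>

lemma smooth_manifold_chartD:
  assumes "smooth_manifold X" "(U, \<phi>) \<in> atlas X"
  shows "openin (mtop X) U" "inj_on \<phi> U"
    "\<And>V. openin (mtop X) V \<Longrightarrow> open (\<phi> ` (U \<inter> V))"
proof -
  have U: "openin (mtop X) U" "open (\<phi> ` U)"
    and hom: "homeomorphic_map (subtopology (mtop X) U) (top_of_set (\<phi> ` U)) \<phi>"
    using assms by (auto simp: smooth_manifold_def)
  have top: "topspace (subtopology (mtop X) U) = U"
    using openin_subset[OF U(1)] by auto
  show "openin (mtop X) U" by (rule U)
  show "inj_on \<phi> U"
    using homeomorphic_imp_injective_map[OF hom] by (simp only: top)
  fix V assume "openin (mtop X) V"
  then have "openin (subtopology (mtop X) U) (U \<inter> V)"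
    by (metis inf_commute openin_subtopology)
  then have "openin (top_of_set (\<phi> ` U)) (\<phi> ` (U \<inter> V))"
    using homeomorphic_imp_open_map[OF hom] by (simp add: open_map_def)
  then show "open (\<phi> ` (U \<inter> V))"
    using U(2) openin_open_trans by blast
qed

lemma smooth_manifold_chart_at:
  assumes "smooth_manifold X" "x \<in> topspace (mtop X)"
  obtains U \<phi> where "(U, \<phi>) \<in> atlas X" "x \<in> U"
proof -
  have "x \<in> (\<Union>(U, \<phi>)\<in>atlas X. U)"
    using assms by (simp add: smooth_manifold_def)
  with that show ?thesis by blast
qed

lemma Ck_mapI:
  assumes "continuous_map (mtop X) (mtop Y) f"
    and "\<And>U \<phi> V \<psi>. (U, \<phi>) \<in> atlas X \<Longrightarrow> (V, \<psi>) \<in> atlas Y \<Longrightarrow>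
      Ck_on k (\<psi> \<circ> f \<circ> inv_into U \<phi>) (\<phi> ` (U \<inter> f -` V))"
  shows "Ck_map k X Y f"
  using assms by (auto simp: Ck_map_def)

lemma open_chart_preimage:
  assumes X: "smooth_manifold X" "(U, \<phi>) \<in> atlas X" and Y: "smooth_manifold Y" "(V, \<psi>) \<in> atlas Y"
    and f: "continuous_map (mtop X) (mtop Y) f"
  shows "open (\<phi> ` (U \<inter> f -` V))"
proof -
  have "openin (mtop X) {x \<in> topspace (mtop X). f x \<in> V}"
    using f smooth_manifold_chartD(1)[OF Y] by (simp add: continuous_map_def)
  moreover have "U \<inter> {x \<in> topspace (mtop X). f x \<in> V} = U \<inter> f -` V"
    using openin_subset[OF smooth_manifold_chartD(1)[OF X]] by auto
  ultimately show ?thesis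
    using smooth_manifold_chartD(3)[OF X] by metis
qed

text \<open>Near a given point, a chart \<open>V\<close> of \<open>Y\<close> around the image under
  \<open>f\<close> is inserted between the charts of \<open>X\<close> and \<open>Z\<close>; the
  chain rule applies to the two resulting chart expressions.\<close>

lemma Ck_map_1_compose:
  assumes X: "smooth_manifold X" and Y: "smooth_manifold Y" and Z: "smooth_manifold Z"
    and f: "Ck_map 1 X Y f" and g: "Ck_map 1 Y Z g"
  shows "Ck_map 1 X Z (g \<circ> f)"
proof (rule Ck_mapI)
  have cf: "continuous_map (mtop X) (mtop Y) f" and cg: "continuous_map (mtop Y) (mtop Z) g"
    using f g by (auto simp: Ck_map_def)
  then show "continuous_map (mtop X) (mtop Z) (g \<circ> f)"
    by (rule continuous_map_compose)
  fix U \<phi> W \<xi>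
  assume U: "(U, \<phi>) \<in> atlas X" and W: "(W, \<xi>) \<in> atlas Z"
  let ?G = "\<xi> \<circ> (g \<circ> f) \<circ> inv_into U \<phi>"
  show "Ck_on 1 ?G (\<phi> ` (U \<inter> (g \<circ> f) -` W))"
  proof (rule Ck_on_local)
    fix p assume "p \<in> \<phi> ` (U \<inter> (g \<circ> f) -` W)"
    then obtain x where x: "x \<in> U" "g (f x) \<in> W" "p = \<phi> x"
      by auto
    note Uo = smooth_manifold_chartD[OF X U]
    have "x \<in> topspace (mtop X)"
      using Uo(1) x(1) openin_subset by blast
    then have "f x \<in> topspace (mtop Y)"
      using cf by (auto simp: continuous_map_def)
    then obtain V \<psi> where V: "(V, \<psi>) \<in> atlas Y" "f x \<in> V"
      using smooth_manifold_chart_at[OF Y] by blast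
    note Vo = smooth_manifold_chartD[OF Y V(1)]
    define P where "P = \<psi> \<circ> f \<circ> inv_into U \<phi>"
    define Q where "Q = \<xi> \<circ> g \<circ> inv_into V \<psi>"
    define S where "S = \<phi> ` (U \<inter> f -` V)"
    define T where "T = \<psi> ` (V \<inter> g -` W)"
    have P: "Ck_on 1 P S"
      using f U V(1) by (auto simp: Ck_map_def P_def S_def)
    have Q: "Ck_on 1 Q T"
      using g W V(1) by (auto simp: Ck_map_def Q_def T_def)
    have S: "open S" and T: "open T"
      unfolding S_def T_def using open_chart_preimage X Y Z U V(1) W cf cg by blast+
    \<comment> \<open>These are the coordinates of points that \<open>f\<close> sends into
      \<open>V\<close> and \<open>g \<circ> f\<close> into \<open>W\<close>. There
      \<open>Q \<circ> P\<close> is the chart expression of the composite, because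
      \<open>inv_into V \<psi>\<close> undoes \<open>\<psi>\<close>.\<close>
    have N: "open (S \<inter> P -` T)"
      using P S T by (intro continuous_open_preimage) (auto simp: Ck_on_1_iff)
    moreover have "p \<in> S \<inter> P -` T"
      using x V(2) Uo(2) by (auto simp: S_def T_def P_def)
    moreover have "Ck_on 1 (Q \<circ> P) (S \<inter> P -` T)"
      using Ck_on_subset[OF P _ S] Q by (intro Ck_on_1_compose[of P _ Q T]) auto
    moreover have "(Q \<circ> P) y = ?G y" if "y \<in> S" for y
      using that Uo(2) Vo(2) by (auto simp: S_def P_def Q_def)
    ultimately show "\<exists>N g'. open N \<and> p \<in> N \<and> Ck_on 1 g' N \<and> (\<forall>y\<in>N. g' y = ?G y)"
      by blast
  qed
qed

section \<open>The torus as a smooth manifold\<close>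

lemma int_lattice_zero: "0 \<in> int_lattice"
  and int_lattice_add: "x \<in> int_lattice \<Longrightarrow> y \<in> int_lattice \<Longrightarrow> x + y \<in> int_lattice"
  and int_lattice_diff: "x \<in> int_lattice \<Longrightarrow> y \<in> int_lattice \<Longrightarrow> x - y \<in> int_lattice"
  by (auto simp: int_lattice_def)

lemma int_lattice_mult:
  "z \<in> int_lattice \<Longrightarrow> map_matrix real_of_int A *v z \<in> int_lattice"
  by (auto simp: int_lattice_def matrix_vector_mult_def intro!: Ints_sum Ints_mult)

lemma int_lattice_axis: "axis j 1 \<in> int_lattice"
  by (auto simp: int_lattice_def axis_def)

lemma int_lattice_discrete:
  assumes "z \<in> int_lattice" "norm z < 1"
  shows "z = 0"
proof -
  have "z $ i = 0" for i
    using assms component_le_norm_cart[of z i]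
    by (intro Ints_nonzero_abs_less1) (auto simp: int_lattice_def)
  then show ?thesis
    by (simp add: vec_eq_iff)
qed

lemma closed_int_lattice: "closed (int_lattice :: (real ^ 'a) set)"
proof -
  have "int_lattice = (\<Inter>i. (\<lambda>z :: real ^ 'a. z $ i) -` \<int>)"
    by (auto simp: int_lattice_def)
  moreover have "closed (\<Inter>i. (\<lambda>z :: real ^ 'a. z $ i) -` \<int>)"
    by (intro closed_INT ballI closed_vimage closed_Ints continuous_intros)
  ultimately show ?thesis
    by simp
qed

lemma torus_proj_eq_iff: "torus_proj x = torus_proj y \<longleftrightarrow> x - y \<in> int_lattice"
proof
  assume eq: "torus_proj x = torus_proj y"
  have "x + 0 \<in> torus_proj x"
    unfolding torus_proj_def using int_lattice_zero by blast
  then obtain z where "z \<in> int_lattice" "x + 0 = y + z"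
    unfolding eq unfolding torus_proj_def by blast
  then show "x - y \<in> int_lattice"
    by simp
next
  have sub: "torus_proj u \<subseteq> torus_proj v" if "u - v \<in> int_lattice" for u v :: "real ^ 'a"
  proof (clarsimp simp: torus_proj_def)
    fix z :: "real ^ 'a" assume "z \<in> int_lattice"
    then have "u - v + z \<in> int_lattice"
      using that by (rule int_lattice_add[rotated])
    then show "u + z \<in> (+) v ` int_lattice"
      by (intro image_eqI[of _ _ "u - v + z"]) auto
  qed
  assume xy: "x - y \<in> int_lattice"
  moreover from this have "y - x \<in> int_lattice"
    using int_lattice_diff[OF int_lattice_zero] by fastforce
  ultimately show "torus_proj x = torus_proj y"
    by (simp add: sub subset_antisym)
qed

lemma torus_proj_add_lattice: "z \<in> int_lattice \<Longrightarrow> torus_proj (x + z) = torus_proj x"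
  by (simp add: torus_proj_eq_iff)

text \<open>Two points of such a ball are at distance less than 1, while distinct points of one
  coset differ by a nonzero lattice vector, of norm at least 1. These balls provide charts around
  every point.\<close>

lemma inj_on_torus_proj_ball: "inj_on torus_proj (ball x (1/2))"
proof (rule inj_onI)
  fix u v assume uv: "u \<in> ball x (1/2)" "v \<in> ball x (1/2)" "torus_proj u = torus_proj v"
  then have "dist u v < 1"
    using dist_triangle_half_l[of u x 1 v] by (simp add: dist_commute)
  then show "u = v"
    using uv(3) int_lattice_discrete[of "u - v"] by (simp add: torus_proj_eq_iff dist_norm)
qed

text \<open>The full preimage of the image of \<open>W\<close> is the union of the lattice
  translates of \<open>W\<close>.\<close>

lemma openin_torus_proj_image:
  assumes "open W"
  shows "openin torus_topology (torus_proj ` W)"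
proof -
  have "torus_proj -` torus_proj ` W = (\<Union>z\<in>int_lattice. (+) z ` W)"
  proof (intro subset_antisym subsetI)
    fix x assume "x \<in> torus_proj -` torus_proj ` W"
    then obtain w where w: "w \<in> W" "x - w \<in> int_lattice"
      by (auto simp: torus_proj_eq_iff)
    then show "x \<in> (\<Union>z\<in>int_lattice. (+) z ` W)"
      by (intro UN_I[of "x - w"] image_eqI[of _ _ w]) auto
  next
    fix x assume "x \<in> (\<Union>z\<in>int_lattice. (+) z ` W)"
    then obtain z w where zw: "z \<in> int_lattice" "w \<in> W" "x = w + z"
      by (auto simp: add.commute)
    then show "x \<in> torus_proj -` torus_proj ` W"
      by (auto simp: torus_proj_add_lattice)
  qed
  then show ?thesis
    using assms by (auto simp: openin_torus_topology intro!: open_UN open_translation)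
qed

lemma continuous_map_torus_proj: "continuous_map euclidean torus_topology torus_proj"
  using quotient_map_torus_proj by (rule quotient_imp_continuous_map)

lemma open_map_torus_proj: "open_map euclidean torus_topology torus_proj"
  by (auto simp: open_map_def openin_torus_proj_image)

text \<open>The lattice is closed, so the difference of representatives of two distinct points has a
  ball of some radius \<open>e\<close> free of lattice vectors. Balls of radius \<open>e/2\<close>
  around the representatives then have disjoint projections.\<close>

lemma Hausdorff_space_torus: "Hausdorff_space (torus_topology :: (real ^ 'n) set topology)"
  unfolding Hausdorff_space_def
proof (intro allI impI)
  fix p q :: "(real ^ 'n) set"
  assume "p \<in> topspace torus_topology \<and> q \<in> topspace torus_topology \<and> p \<noteq> q"
  then obtain x y where xy: "p = torus_proj x" "q = torus_proj y" "x - y \<notin> int_lattice"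
    unfolding topspace_torus_topology by (metis imageE torus_proj_eq_iff)
  then obtain e where e: "e > 0" "ball (x - y) e \<subseteq> - int_lattice"
    using closed_int_lattice by (metis ComplI closed_def open_contains_ball)
  have "disjnt (torus_proj ` ball x (e/2)) (torus_proj ` ball y (e/2))"
  proof (rule ccontr)
    assume "\<not> ?thesis"
    then obtain u v where uv: "dist x u < e/2" "dist y v < e/2" "u - v \<in> int_lattice"
      by (auto simp: disjnt_iff torus_proj_eq_iff)
    have "dist (x - y) (u - v) \<le> dist x u + dist y v"
      using norm_triangle_ineq4[of "x - u" "y - v"] by (simp add: dist_norm algebra_simps)
    then have "u - v \<in> ball (x - y) e"
      using uv by simp
    then show False
      using e uv by blast
  qed
  moreover have "p \<in> torus_proj ` ball x (e/2)" "q \<in> torus_proj ` ball y (e/2)"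
    using xy(1,2) e(1) by simp_all
  ultimately show "\<exists>U V. openin torus_topology U \<and> openin torus_topology V \<and> p \<in> U \<and> q \<in> V \<and> disjnt U V"
    using openin_torus_proj_image[OF open_ball] by metis
qed

lemma second_countable_torus: "second_countable (torus_topology :: (real ^ 'n) set topology)"
proof (rule second_countable_open_map_image[OF continuous_map_torus_proj open_map_torus_proj])
  obtain B :: "(real ^ 'n) set set" where B: "countable B" "topological_basis B"
    using ex_countable_basis by blast
  have "\<forall>V\<in>B. openin euclidean V"
    using topological_basis_open[OF B(2)] by simp
  moreover have "\<forall>U x. openin euclidean U \<and> x \<in> U \<longrightarrow> (\<exists>V\<in>B. x \<in> V \<and> V \<subseteq> U)"
    using topological_basisE[OF B(2)] by (metis open_openin)
  ultimately show "second_countable (euclidean :: (real ^ 'n) topology)"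
    using B(1) unfolding second_countable_def by blast
qed (simp add: topspace_torus_topology)

text \<open>Chart expressions take \<open>inv_into\<close> of a chart that is itself an
  \<open>inv_into\<close>. On \<open>W\<close> the two cancel to \<open>torus_proj\<close>, and the
  coordinate domains become plain subsets of \<open>W\<close>.\<close>

lemma torus_chart_image:
  assumes "inj_on torus_proj W"
  shows "inv_into W torus_proj ` (torus_proj ` W \<inter> C) = {x \<in> W. torus_proj x \<in> C}"
    "x \<in> W \<Longrightarrow> inv_into (torus_proj ` W) (inv_into W torus_proj) x = torus_proj x"
proof -
  show "inv_into W torus_proj ` (torus_proj ` W \<inter> C) = {x \<in> W. torus_proj x \<in> C}"
    using assms by force
  have "inj_on (inv_into W torus_proj) (torus_proj ` W)"
    by (simp add: inj_on_inv_into)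
  then show "inv_into (torus_proj ` W) (inv_into W torus_proj) x = torus_proj x" if "x \<in> W"
    using that assms by (metis imageI inv_into_f_f)
qed

lemma homeomorphic_map_torus_chart:
  assumes "open W" "inj_on torus_proj W"
  shows "homeomorphic_map (subtopology torus_topology (torus_proj ` W)) (top_of_set W)
           (inv_into W torus_proj)"
proof -
  let ?T = "subtopology torus_topology (torus_proj ` W)"
  have top: "topspace ?T = torus_proj ` W"
    by (auto simp: topspace_torus_topology)
  have "homeomorphic_map (top_of_set W) ?T torus_proj"
  proof (rule bijective_open_imp_homeomorphic_map)
    show "continuous_map (top_of_set W) ?T torus_proj"
      using continuous_map_torus_proj
      by (auto simp: continuous_map_in_subtopology intro: continuous_map_from_subtopology)
    show "open_map (top_of_set W) ?T torus_proj"
      unfolding open_map_def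
    proof (intro allI impI)
      fix U assume "openin (top_of_set W) U"
      then have U: "open U" "U \<subseteq> W"
        using assms(1) by (auto simp: openin_open_eq)
      then show "openin ?T (torus_proj ` U)"
        by (auto simp: openin_subtopology intro!: exI[of _ "torus_proj ` U"]
            openin_torus_proj_image)
    qed
  qed (use assms top in auto)
  then obtain g where g: "homeomorphic_maps (top_of_set W) ?T torus_proj g"
    by (auto simp: homeomorphic_map_maps)
  then have "homeomorphic_map ?T (top_of_set W) g" "\<And>x. x \<in> W \<Longrightarrow> g (torus_proj x) = x"
    by (auto simp: homeomorphic_maps_map)
  then show ?thesis
    by (elim homeomorphic_map_eq) (auto simp: topspace_torus_topology assms(2))
qed

lemma atlas_torus:
  "(U, \<phi>) \<in> atlas torus \<longleftrightarrow>
     (\<exists>W. U = torus_proj ` W \<and> \<phi> = inv_into W torus_proj \<and> open W \<and> inj_on torus_proj W)"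
  and mtop_torus: "mtop torus = torus_topology"
  by (auto simp: torus_def)

section \<open>Torus maps covered by integer matrices\<close>

lemma continuous_map_torus_integer_matrix:
  assumes h: "\<And>x. h (torus_proj x) = torus_proj (map_matrix real_of_int A *v x)"
  shows "continuous_map torus_topology torus_topology h"
proof -
  have "continuous_map euclidean torus_topology (torus_proj \<circ> (\<lambda>x. map_matrix real_of_int A *v x))"
    by (intro continuous_map_compose[OF _ continuous_map_torus_proj])
      (auto simp: matrix_vector_mult_linear_continuous_on)
  then have "continuous_map euclidean torus_topology (h \<circ> torus_proj)"
    by (simp add: o_def h)
  then show ?thesis
    using continuous_compose_quotient_map quotient_map_torus_proj by blast
qed

text \<open>Locally such a map is affine in charts: the matrix followed by translation by a fixed
  lattice vector. Allowing any \<open>h\<close> covered by a matrix treats the action, its inverses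
  and, through the identity, the changes of charts at once.\<close>

lemma Ck_on_torus_integer_matrix:
  assumes h: "\<And>x. h (torus_proj x) = torus_proj (map_matrix real_of_int A *v x)"
    and "(U, \<phi>) \<in> atlas torus" "(V, \<psi>) \<in> atlas torus"
  shows "Ck_on k (\<psi> \<circ> h \<circ> inv_into U \<phi>) (\<phi> ` (U \<inter> h -` V))"
proof -
  let ?M = "map_matrix real_of_int A"
  obtain W where W: "U = torus_proj ` W" "\<phi> = inv_into W torus_proj" "open W" "inj_on torus_proj W"
    using assms(2) by (auto simp: atlas_torus)
  obtain Z where Z: "V = torus_proj ` Z" "\<psi> = inv_into Z torus_proj" "open Z" "inj_on torus_proj Z"
    using assms(3) by (auto simp: atlas_torus)
  show ?thesis
  proof (rule Ck_on_local)
    fix x assume "x \<in> \<phi> ` (U \<inter> h -` V)"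
    then have x: "x \<in> W" "torus_proj (?M *v x) \<in> torus_proj ` Z"
      using torus_chart_image(1)[OF W(4)] by (auto simp: W(1,2) Z(1) h)
    then obtain y where y: "y \<in> Z" "?M *v x - y \<in> int_lattice"
      by (auto simp: torus_proj_eq_iff)
    \<comment> \<open>The lattice vector that moves the representative \<open>?M *v x\<close> of the
      image to the representative \<open>y\<close> lying in \<open>Z\<close>. Translating by
      \<open>c\<close> does not change the projection.\<close>
    define c where "c = y - ?M *v x"
    define N where "N = W \<inter> (\<lambda>u. ?M *v u + c) -` Z"
    have c: "c \<in> int_lattice"
      using int_lattice_diff[OF int_lattice_zero y(2)] by (simp add: c_def)
    have "open N"
      unfolding N_def using W(3) Z(3)
      by (intro open_Int open_vimage continuous_intros) auto
    moreover have "x \<in> N"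
      using x y by (simp add: N_def c_def)
    moreover have "?M *v u + c = (\<psi> \<circ> h \<circ> inv_into U \<phi>) u" if "u \<in> N" for u
    proof -
      have "h (inv_into U \<phi> u) = torus_proj (?M *v u + c)"
        using that by (simp add: N_def W torus_chart_image(2)[OF W(4)] h c torus_proj_add_lattice)
      then show ?thesis
        using that by (simp add: N_def Z)
    qed
    ultimately show "\<exists>N g. open N \<and> x \<in> N \<and> Ck_on k g N \<and>
        (\<forall>u\<in>N. g u = (\<psi> \<circ> h \<circ> inv_into U \<phi>) u)"
      using Ck_on_affine[OF matrix_vector_mul_bounded_linear[of ?M], of k c N] by blast
  qed
qed

lemma Ck_map_torus_integer_matrix:
  assumes "\<And>x. h (torus_proj x) = torus_proj (map_matrix real_of_int A *v x)"
  shows "Ck_map k torus torus h"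
  using assms continuous_map_torus_integer_matrix[of h A] Ck_on_torus_integer_matrix[of h A]
  by (intro Ck_mapI) (simp_all add: mtop_torus)

lemma smooth_manifold_torus: "smooth_manifold (torus :: ((real ^ 'n) set, real ^ 'n) manifold)"
  unfolding smooth_manifold_def
proof (intro conjI)
  show "Hausdorff_space (mtop (torus :: ((real ^ 'n) set, real ^ 'n) manifold))"
    "second_countable (mtop (torus :: ((real ^ 'n) set, real ^ 'n) manifold))"
    by (simp_all add: mtop_torus Hausdorff_space_torus second_countable_torus)
  show "(\<Union>(U, \<phi>)\<in>atlas (torus :: ((real ^ 'n) set, real ^ 'n) manifold). U) = topspace (mtop torus)"
  proof -
    have "torus_proj x \<in> (\<Union>(U, \<phi>)\<in>atlas torus. U)" for x :: "real ^ 'n"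
    proof (rule UN_I)
      show "(torus_proj ` ball x (1/2), inv_into (ball x (1/2)) torus_proj) \<in> atlas torus"
        using inj_on_torus_proj_ball by (auto simp: atlas_torus)
    qed auto
    then show ?thesis
      by (auto simp: mtop_torus topspace_torus_topology atlas_torus)
  qed
  show "\<forall>(U, \<phi>)\<in>atlas (torus :: ((real ^ 'n) set, real ^ 'n) manifold). openin (mtop torus) U \<and>
      open (\<phi> ` U) \<and> homeomorphic_map (subtopology (mtop torus) U) (top_of_set (\<phi> ` U)) \<phi>"
  proof (safe, goal_cases)
    case (1 U \<phi>)
    then show ?case by (auto simp: atlas_torus mtop_torus openin_torus_proj_image)
  next
    case (2 U \<phi>)
    then show ?case by (auto simp: atlas_torus)
  next
    case (3 U \<phi>)
    then show ?case by (auto simp: atlas_torus mtop_torus homeomorphic_map_torus_chart)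
  qed
  \<comment> \<open>Transition maps are the chart expressions of \<open>id\<close>, which is covered
    by the matrix \<open>mat 1\<close>.\<close>
  show "\<forall>(U, \<phi>)\<in>atlas (torus :: ((real ^ 'n) set, real ^ 'n) manifold). \<forall>(V, \<psi>)\<in>atlas torus.
      Ck_on \<infinity> (\<psi> \<circ> inv_into U \<phi>) (\<phi> ` (U \<inter> V))"
    using Ck_on_torus_integer_matrix[of id "mat 1", where k = \<infinity>]
    by (auto simp: map_matrix_of_int_one)
qed

section \<open>The standard action\<close>

text \<open>An integer matrix maps the lattice into itself; determinant 1 supplies an integer
  inverse, so it maps the lattice onto itself and cosets onto cosets.\<close>

lemma torus_action_proj:
  assumes "det A = 1"
  shows "torus_action A (torus_proj x) = torus_proj (map_matrix real_of_int A *v x)"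
proof -
  let ?M = "map_matrix real_of_int A"
  obtain B where AB: "A ** B = mat 1"
    using int_matrix_inverse[OF assms] by blast
  have inv: "?M *v (map_matrix real_of_int B *v z) = z" for z
    by (simp add: matrix_vector_mul_assoc AB map_matrix_of_int_one flip: map_matrix_of_int_mult)
  have "z \<in> (*v) ?M ` int_lattice" if "z \<in> int_lattice" for z
    using inv[of z] int_lattice_mult[OF that, of B] by (metis imageI)
  then have "(*v) ?M ` int_lattice = int_lattice"
    using int_lattice_mult[of _ A] by blast
  moreover have "torus_action A (torus_proj x) = (+) (?M *v x) ` ((*v) ?M ` int_lattice)"
    by (simp add: torus_action_def) (simp add: torus_proj_def image_image matrix_vector_right_distrib)
  ultimately show ?thesis
    by (simp add: torus_proj_def)
qed

lemma torus_action_mult: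
  assumes "det A = 1" "det B = 1" "p \<in> range torus_proj"
  shows "torus_action (A ** B) p = torus_action A (torus_action B p)"
  using assms by (auto simp: torus_action_proj det_mul map_matrix_of_int_mult matrix_vector_mul_assoc)

lemma torus_action_one: "p \<in> range torus_proj \<Longrightarrow> torus_action (mat 1) p = p"
  by (auto simp: torus_action_proj map_matrix_of_int_one)

lemma torus_action_closed:
  "det A = 1 \<Longrightarrow> p \<in> range torus_proj \<Longrightarrow> torus_action A p \<in> range torus_proj"
  by (auto simp: torus_action_proj)

lemma bij_betw_torus_action:
  assumes "det A = 1"
  shows "bij_betw (torus_action A) (range torus_proj) (range torus_proj)"
proof -
  obtain B where B: "det B = 1" "A ** B = mat 1" "B ** A = mat 1"
    using int_matrix_inverse[OF assms] by blast
  show ?thesis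
    by (rule bij_betw_byWitness[where f' = "torus_action B"])
      (auto simp: torus_action_closed assms B torus_action_one simp flip: torus_action_mult)
qed

lemma Ck_diffeo_torus_action:
  fixes A :: "int ^ 'n ^ 'n"
  assumes "det A = 1"
  shows "Ck_diffeo k torus torus (torus_action A)"
  unfolding Ck_diffeo_def mtop_torus topspace_torus_topology
proof (intro conjI)
  show bij: "bij_betw (torus_action A) (range torus_proj) (range torus_proj)"
    by (rule bij_betw_torus_action[OF assms])
  show "Ck_map k torus torus (torus_action A)"
    using assms by (intro Ck_map_torus_integer_matrix) (rule torus_action_proj)
  obtain B where B: "det B = 1" "A ** B = mat 1" "B ** A = mat 1"
    using int_matrix_inverse[OF assms] by blast
  have "inv_into (range torus_proj) (torus_action A) (torus_proj x) = torus_action B (torus_proj x)"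
    for x :: "real ^ 'n"
    using bij by (intro inv_into_f_eq) (auto simp: bij_betw_def torus_action_closed assms B
        torus_action_one simp flip: torus_action_mult)
  then show "Ck_map k torus torus (inv_into (range torus_proj) (torus_action A))"
    using B(1) by (intro Ck_map_torus_integer_matrix) (simp add: torus_action_proj)
qed

text \<open>Being continuous at \<open>x\<close> with values in a discrete set, \<open>G\<close> is
  constant near \<open>x\<close>. This applies to differences of two lifts of one torus map.\<close>

lemma lattice_valued_has_derivative_zero:
  assumes der: "(G has_derivative D) (at x)" and G: "\<forall>\<^sub>F y in nhds x. G y \<in> int_lattice"
  shows "D = (\<lambda>v. 0)"
proof -
  have "(G \<longlongrightarrow> G x) (nhds x)"
    using has_derivative_continuous[OF der] by (simp add: continuous_within tendsto_at_iff_tendsto_nhds)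
  then have "\<forall>\<^sub>F y in nhds x. dist (G y) (G x) < 1"
    by (rule tendstoD) simp
  then have "\<forall>\<^sub>F y in nhds x. G x = G y"
    using G
  proof eventually_elim
    case (elim y)
    moreover have "G x \<in> int_lattice"
      using G eventually_nhds_x_imp_x by blast
    ultimately show ?case
      using int_lattice_discrete[of "G y - G x"] int_lattice_diff[of "G y" "G x"]
      by (simp add: dist_norm)
  qed
  then obtain N where "open N" "x \<in> N" "\<And>y. y \<in> N \<Longrightarrow> G x = G y"
    by (auto simp: eventually_nhds)
  then have "(G has_derivative (\<lambda>v. 0)) (at x)"
    using has_derivative_transform_within_open[OF has_derivative_const[of "G x"], of N] by blast
  with der show ?thesis
    by (rule has_derivative_unique)
qed

text \<open>Near \<open>x\<close> the difference of the two linear maps has lattice values, so its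
  derivative vanishes; but a linear map is its own derivative. Hence the coincidence set of distinct
  integer matrices has empty interior.\<close>

lemma integer_matrix_agree_interior_empty:
  assumes "x \<in> interior {x. torus_proj (map_matrix real_of_int A *v x)
                             = torus_proj (map_matrix real_of_int B *v x)}"
  shows "A = B"
proof -
  let ?L = "\<lambda>y. map_matrix real_of_int A *v y - map_matrix real_of_int B *v y"
  have der: "(?L has_derivative ?L) (at x)"
    by (intro bounded_linear_imp_has_derivative bounded_linear_sub) auto
  have "\<forall>\<^sub>F y in nhds x. ?L y \<in> int_lattice"
    using eventually_nhds_in_open[OF open_interior assms]
    by eventually_elim (use interior_subset in \<open>auto simp: torus_proj_eq_iff\<close>)
  with der have L0: "?L = (\<lambda>v. 0)"
    by (rule lattice_valued_has_derivative_zero)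
  have "map_matrix real_of_int A *v v = map_matrix real_of_int B *v v" for v
    using fun_cong[OF L0, of v] by simp
  then show ?thesis
    by (metis matrix_eq map_matrix_of_int_eq_iff)
qed

lemma faithful_action_SL_int_torus:
  fixes \<Gamma> :: "(int ^ 'n ^ 'n) set"
  assumes "subgroup \<Gamma> SL_int"
  shows "faithful_action (SL_int\<lparr>carrier := \<Gamma>\<rparr>) (range torus_proj) torus_action"
proof -
  have det: "det A = 1" if "A \<in> \<Gamma>" for A
    using subgroup.subset[OF assms] that by (auto simp: SL_int_def)
  have Bij: "torus_action A \<in> Bij (range torus_proj)" if "A \<in> \<Gamma>" for A
    using bij_betw_torus_action[OF det[OF that]] by (auto simp: Bij_def torus_action_def)
  have "group_action (SL_int\<lparr>carrier := \<Gamma>\<rparr>) (range torus_proj) torus_action"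
  proof (intro group_action.intro group_hom.intro group_hom_axioms.intro homI)
    show "group (SL_int\<lparr>carrier := \<Gamma>\<rparr>)"
      by (rule subgroup.subgroup_is_group[OF assms group_SL_int])
    fix A B assume "A \<in> carrier (SL_int\<lparr>carrier := \<Gamma>\<rparr>)" "B \<in> carrier (SL_int\<lparr>carrier := \<Gamma>\<rparr>)"
    then have AB: "A \<in> \<Gamma>" "B \<in> \<Gamma>" by auto
    \<comment> \<open>Elements of \<open>BijGroup\<close> are compared as total functions, so points
      outside the torus, where both sides are \<open>undefined\<close>, need a case of their
      own.\<close>
    have "torus_action (A ** B) = compose (range torus_proj) (torus_action A) (torus_action B)"
    proof
      fix p :: "(real ^ 'n) set"
      show "torus_action (A ** B) p
          = compose (range torus_proj) (torus_action A) (torus_action B) p"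
      proof (cases "p \<in> range torus_proj")
        case True
        then show ?thesis
          using det[OF AB(1)] det[OF AB(2)] by (simp add: torus_action_mult compose_def)
      next
        case False
        then show ?thesis
          by (simp add: torus_action_def compose_def)
      qed
    qed
    then show "torus_action (A \<otimes>\<^bsub>SL_int\<lparr>carrier := \<Gamma>\<rparr>\<^esub> B)
        = torus_action A \<otimes>\<^bsub>BijGroup (range torus_proj)\<^esub> torus_action B"
      using Bij AB by (simp add: BijGroup_def SL_int_def)
  qed (use Bij in \<open>simp_all add: group_BijGroup\<close>, simp add: BijGroup_def)
  moreover have "inj_on torus_action \<Gamma>"
  proof (rule inj_onI)
    fix A B assume "A \<in> \<Gamma>" "B \<in> \<Gamma>" "torus_action A = torus_action B"
    then have "torus_proj (map_matrix real_of_int A *v x) = torus_proj (map_matrix real_of_int B *v x)"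
      for x
      using det by (metis torus_action_proj)
    \<comment> \<open>The coincidence set is the whole space, so any point, here \<open>0\<close>,
      is interior.\<close>
    then show "A = B"
      using integer_matrix_agree_interior_empty[of 0 A B] by simp
  qed
  ultimately show ?thesis
    by (simp add: faithful_action_def faithful_action_axioms_def)
qed

section \<open>Rigidity\<close>

text \<open>The frontier of a closed set has empty interior, so by Baire the points off all the
  frontiers are dense. Each of them lies in some \<open>C i\<close>, and therefore in its
  interior.\<close>

lemma Baire_cover_interior_dense:
  fixes C :: "'i \<Rightarrow> 'a :: {real_normed_vector, heine_borel} set"
  assumes "countable I" "\<And>i. i \<in> I \<Longrightarrow> closed (C i)" "(\<Union>i\<in>I. C i) = UNIV"
  shows "closure (\<Union>i\<in>I. interior (C i)) = UNIV"
proof -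
  have "UNIV \<subseteq> closure (\<Inter>i\<in>I. - frontier (C i))"
  proof (rule Baire)
    fix T assume "T \<in> (\<lambda>i. - frontier (C i)) ` I"
    then obtain i where i: "i \<in> I" "T = - frontier (C i)" by blast
    have "interior (frontier (C i)) = {}"
      using assms(2)[OF i(1)] interior_subset[of "frontier (C i)"] interior_mono[of "frontier (C i)" "C i"]
      by (auto simp: frontier_def)
    then show "openin (top_of_set UNIV) T \<and> UNIV \<subseteq> closure T"
      using i(2) by (simp add: closure_complement frontier_closed open_Compl)
  qed (use assms(1) in auto)
  also have "(\<Inter>i\<in>I. - frontier (C i)) \<subseteq> (\<Union>i\<in>I. interior (C i))"
  proof
    fix x assume x: "x \<in> (\<Inter>i\<in>I. - frontier (C i))"
    obtain i where "i \<in> I" "x \<in> C i"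
      using assms(3) by blast
    with x show "x \<in> (\<Union>i\<in>I. interior (C i))"
      using closure_subset by (fastforce simp: frontier_def)
  qed
  finally show ?thesis
    by (meson closure_mono subset_trans top.extremum_uniqueI)
qed

lemma closed_torus_agree:
  assumes "continuous_map torus_topology torus_topology h"
  shows "closed {x. h (torus_proj x) = torus_proj (map_matrix real_of_int A *v x)}"
proof -
  have "continuous_map euclidean torus_topology (h \<circ> torus_proj)"
    using continuous_map_compose[OF continuous_map_torus_proj assms] .
  moreover have "continuous_map euclidean torus_topology
      (torus_proj \<circ> (\<lambda>x. map_matrix real_of_int A *v x))"
    by (intro continuous_map_compose[OF _ continuous_map_torus_proj])
      (auto simp: matrix_vector_mult_linear_continuous_on)
  ultimately have "closedin euclidean {x \<in> topspace euclidean.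
      (h \<circ> torus_proj) x = (torus_proj \<circ> (\<lambda>x. map_matrix real_of_int A *v x)) x}"
    using Hausdorff_space_torus by (intro closedin_continuous_maps_eq)
  then show ?thesis
    by (simp add: o_def)
qed

text \<open>Charts give \<open>h\<close> a C^1 lift \<open>F\<close> on a ball around
  \<open>x0\<close>. Its derivative is an integer matrix on a dense set, hence, by continuity and
  closedness of the lattice, everywhere on the ball, and then constant. The lift is thus affine with
  an integer matrix, and one good point of the ball fixes the translation modulo the
  lattice.\<close>

lemma torus_C1_orbit_map_locally_integer_matrix:
  fixes h :: "(real ^ 'n) set \<Rightarrow> (real ^ 'n) set" and \<Gamma> :: "(int ^ 'n ^ 'n) set"
  assumes h: "Ck_map 1 torus torus h"
    and orb: "\<And>x. \<exists>A\<in>\<Gamma>. h (torus_proj x) = torus_proj (map_matrix real_of_int A *v x)"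
  shows "\<exists>A\<in>\<Gamma>. x0 \<in> interior {x. h (torus_proj x) = torus_proj (map_matrix real_of_int A *v x)}"
proof -
  define C where "C = (\<lambda>A. {x. h (torus_proj x) = torus_proj (map_matrix real_of_int A *v x)})"
  have ch: "continuous_map torus_topology torus_topology h"
    using h by (simp add: Ck_map_def mtop_torus)
  have dense: "closure (\<Union>A\<in>\<Gamma>. interior (C A)) = UNIV"
  proof (rule Baire_cover_interior_dense)
    show "closed (C A)" for A
      unfolding C_def by (rule closed_torus_agree[OF ch])
    show "(\<Union>A\<in>\<Gamma>. C A) = UNIV"
      using orb by (auto simp: C_def)
  qed auto
  obtain y0 where y0: "h (torus_proj x0) = torus_proj y0"
    using orb by blast
  define W where "W = ball x0 (1/2)"
  define V where "V = ball y0 (1/2)"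
  have W: "open W" "inj_on torus_proj W" "x0 \<in> W" and V: "open V" "inj_on torus_proj V" "y0 \<in> V"
    using inj_on_torus_proj_ball by (auto simp: W_def V_def)
  let ?\<phi> = "inv_into W torus_proj" and ?\<psi> = "inv_into V torus_proj"
  define F where "F = ?\<psi> \<circ> h \<circ> inv_into (torus_proj ` W) ?\<phi>"
  define S where "S = {x \<in> W. h (torus_proj x) \<in> torus_proj ` V}"
  have atl: "(torus_proj ` W, ?\<phi>) \<in> atlas torus" "(torus_proj ` V, ?\<psi>) \<in> atlas torus"
    using W V by (auto simp: atlas_torus)
  have S_eq: "?\<phi> ` (torus_proj ` W \<inter> h -` torus_proj ` V) = S"
    using torus_chart_image(1)[OF W(2)] by (auto simp: S_def)
  have FS: "Ck_on 1 F S"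
    using h atl unfolding F_def S_eq[symmetric] Ck_map_def by fastforce
  have "open S"
    unfolding S_eq[symmetric] using atl ch
    by (intro open_chart_preimage[OF smooth_manifold_torus _ smooth_manifold_torus])
      (auto simp: mtop_torus)
  moreover have "x0 \<in> S"
    using W V y0 by (auto simp: S_def)
  ultimately obtain r where r: "r > 0" "ball x0 r \<subseteq> S"
    using open_contains_ball by blast
  \<comment> \<open>On this ball \<open>h\<close> stays within the target chart. Connectedness will
    make the derivative constant, and convexity will make a function with zero derivative
    constant.\<close>
  define B where "B = ball x0 r"
  have B: "B \<subseteq> S" "open B" "x0 \<in> B" "connected B" "convex B"
    using r by (auto simp: B_def)
  have lift: "torus_proj (F x) = h (torus_proj x)" if "x \<in> B" for x
  proof -
    have "x \<in> S" using that B(1) by blast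
    then show ?thesis
      by (auto simp: F_def S_def torus_chart_image(2)[OF W(2)] f_inv_into_f)
  qed
  define D where "D = (\<lambda>x. frechet_derivative F (at x))"
  have der: "(F has_derivative D x) (at x)" if "x \<in> B" for x
    using FS B(1) that by (auto simp: Ck_on_1_iff D_def frechet_derivative_works)
  have cont: "continuous_on B (\<lambda>x. D x v)" for v
    using FS B(1) by (auto simp: Ck_on_1_iff D_def intro: continuous_on_subset)
  have D_eq: "D x = (*v) (map_matrix real_of_int A)" if "x \<in> B" "x \<in> interior (C A)" for x A
  proof -
    let ?M = "map_matrix real_of_int A"
    have dG: "((\<lambda>y. F y - ?M *v y) has_derivative (\<lambda>v. D x v - ?M *v v)) (at x)"
      by (intro has_derivative_diff der[OF that(1)] bounded_linear_imp_has_derivative) auto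
    have lattice: "F y - ?M *v y \<in> int_lattice" if "y \<in> B" "y \<in> C A" for y
      using lift[OF that(1)] that(2) by (simp add: C_def flip: torus_proj_eq_iff)
    have "\<forall>\<^sub>F y in nhds x. F y - ?M *v y \<in> int_lattice"
      using eventually_nhds_in_open[OF B(2) that(1)] eventually_nhds_in_open[OF open_interior that(2)]
      by eventually_elim (use interior_subset lattice in blast)
    with dG have "(\<lambda>v. D x v - ?M *v v) = (\<lambda>v. 0)"
      by (rule lattice_valued_has_derivative_zero)
    then have "D x v - ?M *v v = 0" for v
      by metis
    then show ?thesis
      by (simp add: fun_eq_iff)
  qed
  \<comment> \<open>The point \<open>p\<close> supplies the matrix \<open>A\<close> that will serve
    on the whole ball.\<close>
  have "B \<inter> (\<Union>A\<in>\<Gamma>. interior (C A)) \<noteq> {}"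
    using dense B(2,3) by (metis UNIV_I closure_iff_nhds_not_empty inf_commute subset_refl)
  then obtain p A where p: "p \<in> B" "A \<in> \<Gamma>" "p \<in> interior (C A)"
    by blast
  let ?M = "map_matrix real_of_int A"
  \<comment> \<open>If a column of the derivative left the closed lattice at \<open>x\<close>, it
    would do so on an open set, which meets the dense set where \<open>D_eq\<close> makes the
    derivative an integer matrix.\<close>
  have D_lattice: "D x (axis j 1) \<in> int_lattice" if "x \<in> B" for x j
  proof (rule ccontr)
    assume "D x (axis j 1) \<notin> int_lattice"
    then have "x \<in> B \<inter> (\<lambda>x. D x (axis j 1)) -` (- int_lattice)"
      using that by simp
    moreover have "open (B \<inter> (\<lambda>x. D x (axis j 1)) -` (- int_lattice))"
      using cont B(2) closed_int_lattice by (intro continuous_open_preimage) auto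
    ultimately have "(\<Union>A\<in>\<Gamma>. interior (C A)) \<inter> (B \<inter> (\<lambda>x. D x (axis j 1)) -` (- int_lattice)) \<noteq> {}"
      using dense by (metis UNIV_I closure_iff_nhds_not_empty subset_refl)
    then show False
      using D_eq by (auto simp: int_lattice_mult int_lattice_axis)
  qed
  have D_const: "D x (axis j 1) = D p (axis j 1)" if "x \<in> B" for x j
  proof -
    have "D x (axis j 1) $ i = D p (axis j 1) $ i" for i
    proof -
      \<comment> \<open>A continuous function with integer values is constant on a connected set,
        distinct integers being at distance at least 1.\<close>
      have "(\<lambda>x. D x (axis j 1) $ i) constant_on B"
      proof (rule continuous_discrete_range_constant[OF B(4)])
        show "continuous_on B (\<lambda>x. D x (axis j 1) $ i)"
          by (intro continuous_intros cont)
        fix u assume u: "u \<in> B"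
        have "1 \<le> norm (D y (axis j 1) $ i - D u (axis j 1) $ i)"
          if "y \<in> B" "D y (axis j 1) $ i \<noteq> D u (axis j 1) $ i" for y
          using D_lattice[OF u, of j] D_lattice[OF that(1), of j] that(2)
            Ints_eq_abs_less1[of "D y (axis j 1) $ i" "D u (axis j 1) $ i"]
          by (auto simp: int_lattice_def)
        then show "\<exists>e>0. \<forall>y. y \<in> B \<and> D y (axis j 1) $ i \<noteq> D u (axis j 1) $ i \<longrightarrow>
            e \<le> norm (D y (axis j 1) $ i - D u (axis j 1) $ i)"
          by (intro exI[of _ 1]) auto
      qed
      then show ?thesis
        using that p(1) unfolding constant_on_def by metis
    qed
    then show ?thesis
      by (simp add: vec_eq_iff)
  qed
  have D_M: "D x = (*v) ?M" if "x \<in> B" for x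
  proof
    fix v
    have lin: "linear (D x)" "linear ((*v) ?M)"
      using der[OF that] has_derivative_linear by auto
    have "\<forall>b\<in>Basis. D x b = ?M *v b"
      using D_const[OF that] D_eq[OF p(1,3)] by (auto simp: Basis_vec_def)
    then show "D x v = ?M *v v"
      using linear_eq_stdbasis[OF lin] by metis
  qed
  have zero: "((\<lambda>y. F y - ?M *v y) has_derivative (\<lambda>v. 0)) (at x within B)" if "x \<in> B" for x
  proof -
    have "((\<lambda>y. F y - ?M *v y) has_derivative (\<lambda>v. D x v - ?M *v v)) (at x)"
      by (intro has_derivative_diff der[OF that] bounded_linear_imp_has_derivative) auto
    then show ?thesis
      using D_M[OF that] by (simp add: has_derivative_at_withinI)
  qed
  \<comment> \<open>The difference has zero derivative, so it keeps its value at \<open>p\<close>,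
    which is a lattice vector because \<open>p\<close> lies in \<open>C A\<close>.\<close>
  have F_const: "F x - ?M *v x = F p - ?M *v p" if "x \<in> B" for x
    by (rule has_derivative_zero_unique[OF B(5) zero that p(1)])
  have "p \<in> C A"
    using p(3) interior_subset by blast
  then have "F p - ?M *v p \<in> int_lattice"
    using lift[OF p(1)] by (simp add: C_def flip: torus_proj_eq_iff)
  then have "torus_proj (F x) = torus_proj (?M *v x)" if "x \<in> B" for x
    using F_const[OF that] by (simp add: torus_proj_eq_iff)
  then have "B \<subseteq> C A"
    using lift by (auto simp: C_def)
  then have "x0 \<in> interior (C A)"
    using B(2,3) interior_maximal by blast
  with p(2) show ?thesis
    by (auto simp: C_def)
qed

text \<open>The open sets \<open>U A\<close> cover the space by the local result and are disjoint
  for distinct matrices. Each is then also closed, and connectedness leaves only one nonempty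
  set.\<close>

lemma torus_C1_orbit_map_integer_matrix:
  fixes h :: "(real ^ 'n) set \<Rightarrow> (real ^ 'n) set" and \<Gamma> :: "(int ^ 'n ^ 'n) set"
  assumes "Ck_map 1 torus torus h"
    and "\<And>x. \<exists>A\<in>\<Gamma>. h (torus_proj x) = torus_proj (map_matrix real_of_int A *v x)"
  shows "\<exists>A\<in>\<Gamma>. \<forall>x. h (torus_proj x) = torus_proj (map_matrix real_of_int A *v x)"
proof -
  define U where
    "U = (\<lambda>A. interior {x. h (torus_proj x) = torus_proj (map_matrix real_of_int A *v x)})"
  have cover: "\<exists>A\<in>\<Gamma>. x \<in> U A" for x
    unfolding U_def by (rule torus_C1_orbit_map_locally_integer_matrix[OF assms])
  have disj: "A = B" if "x \<in> U A" "x \<in> U B" for x A B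
  proof (rule integer_matrix_agree_interior_empty)
    have h: "h (torus_proj y) = torus_proj (map_matrix real_of_int A' *v y)" if "y \<in> U A'" for A' y
      using that interior_subset unfolding U_def by blast
    have "U A \<inter> U B \<subseteq> {x. torus_proj (map_matrix real_of_int A *v x)
                             = torus_proj (map_matrix real_of_int B *v x)}"
    proof clarify
      fix y assume "y \<in> U A" "y \<in> U B"
      then show "torus_proj (map_matrix real_of_int A *v y)
          = torus_proj (map_matrix real_of_int B *v y)"
        using h[of y A] h[of y B] by simp
    qed
    moreover have "open (U A \<inter> U B)"
      by (auto simp: U_def)
    ultimately show "x \<in> interior {x. torus_proj (map_matrix real_of_int A *v x)
                             = torus_proj (map_matrix real_of_int B *v x)}"
      using that interior_maximal by blast
  qed
  obtain A where A: "A \<in> \<Gamma>" "0 \<in> U A"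
    using cover by blast
  have "- U A = (\<Union>B\<in>\<Gamma> - {A}. U B)"
    using cover disj by blast
  moreover have "open (\<Union>B\<in>\<Gamma> - {A}. U B)"
    by (auto simp: U_def)
  ultimately have "closed (U A)"
    by (simp add: closed_def)
  then have "U A = UNIV"
    using A clopen[of "U A"] by (auto simp: U_def)
  then show ?thesis
    using A(1) interior_subset unfolding U_def by fastforce
qed

text \<open>There are countably many pairs of distinct integer matrices, and each coincidence set is
  closed with empty interior, so by Baire they cannot cover the space. At such a point, equality of
  images becomes equality of matrices.\<close>

lemma exists_torus_point_free:
  "\<exists>x :: real ^ 'n. \<forall>A B. torus_proj (map_matrix real_of_int A *v x)
      = torus_proj (map_matrix real_of_int B *v x) \<longrightarrow> A = (B :: int ^ 'n ^ 'n)"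
proof (rule ccontr)
  let ?C = "\<lambda>(A, B). {x :: real ^ 'n. torus_proj (map_matrix real_of_int A *v x)
      = torus_proj (map_matrix real_of_int B *v x)}"
  let ?I = "{(A, B). A \<noteq> (B :: int ^ 'n ^ 'n)}"
  assume "\<not> ?thesis"
  then have un: "(\<Union>i\<in>?I. ?C i) = UNIV"
    by fastforce
  have "closure (\<Union>i\<in>?I. interior (?C i)) = UNIV"
  proof (rule Baire_cover_interior_dense[OF _ _ un])
    fix i assume "i \<in> ?I"
    obtain A B where i: "i = (A, B)" by fastforce
    have *: "?C i = {x. map_matrix real_of_int A *v x - map_matrix real_of_int B *v x \<in> int_lattice}"
      by (simp add: i torus_proj_eq_iff)
    have "closed ((\<lambda>x. map_matrix real_of_int A *v x - map_matrix real_of_int B *v x) -` int_lattice)"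
      by (intro closed_vimage closed_int_lattice continuous_intros)
    then show "closed (?C i)"
      unfolding * by (simp add: vimage_def)
  qed auto
  moreover have "interior (?C i) = {}" if "i \<in> ?I" for i
    using that integer_matrix_agree_interior_empty by fastforce
  ultimately show False
    by simp
qed

section \<open>Rigidity of the standard action\<close>

theorem theorem0p4:
  fixes \<Gamma> :: "(int ^ 'n ^ 'n) set"
  assumes "subgroup \<Gamma> SL_int"
    and "finite (rcosets\<^bsub>SL_int\<^esub> \<Gamma>)"
  shows "Ck_OE_rigid TYPE('b) TYPE('l::euclidean_space) TYPE('h) 1
           torus (SL_int\<lparr>carrier := \<Gamma>\<rparr>) torus_action"
  unfolding Ck_OE_rigid_def
proof (intro conjI allI impI)
  let ?T = "range (torus_proj :: real ^ 'n \<Rightarrow> _)" and ?G = "SL_int\<lparr>carrier := \<Gamma>\<rparr>"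
  have det: "det A = 1" if "A \<in> \<Gamma>" for A
    using subgroup.subset[OF assms(1)] that by (auto simp: SL_int_def)
  show "Ck_action \<infinity> torus ?G torus_action"
    using smooth_manifold_torus faithful_action_SL_int_torus[OF assms(1)] Ck_diffeo_torus_action[OF det]
    by (auto simp: Ck_action_def mtop_torus topspace_torus_topology)
  fix X' :: "('b, 'l) manifold" and G' :: "'h monoid" and \<alpha>' and f :: "'b \<Rightarrow> (real ^ 'n) set"
  assume act: "Ck_action 1 X' G' \<alpha>'"
    and oe: "orbit_equivalence (mtop X') G' \<alpha>' (mtop torus) ?G torus_action f"
    and diff: "Ck_diffeo 1 X' torus f"
  define E where "E = topspace (mtop X')"
  define k where "k = inv_into E f"
  have bij: "bij_betw f E ?T" and f1: "Ck_map 1 X' torus f" and k1: "Ck_map 1 torus X' k"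
    using diff by (auto simp: Ck_diffeo_def E_def k_def mtop_torus topspace_torus_topology)
  have X': "smooth_manifold X'" and a1: "\<And>g. g \<in> carrier G' \<Longrightarrow> Ck_map 1 X' X' (\<alpha>' g)"
    using act by (auto simp: Ck_action_def Ck_diffeo_def)
  interpret \<alpha>': faithful_action G' E \<alpha>'
    using act by (auto simp: Ck_action_def E_def)
  have k: "k p \<in> E" "f (k p) = p" if "p \<in> ?T" for p
    using bij that unfolding k_def bij_betw_def
    by (metis inv_into_into, metis f_inv_into_f)
  have kf: "k (f e) = e" if "e \<in> E" for e
    using bij that by (simp add: k_def bij_betw_def)
  have fE: "f e \<in> ?T" if "e \<in> E" for e
    using bij that by (auto simp: bij_betw_def)
  have orbit: "e' \<in> orbit G' \<alpha>' e \<longleftrightarrow> (\<exists>A\<in>\<Gamma>. f e' = torus_action A (f e))"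
    if "e \<in> E" "e' \<in> E" for e e'
    using oe that by (auto simp: orbit_equivalence_def E_def orbit_def)
  \<comment> \<open>The transported map \<open>f \<circ> \<alpha>' g \<circ> k\<close> is C^1 and
    moves each point within its orbit under \<open>\<Gamma>\<close>, since \<open>f\<close> carries
    orbits to orbits; hence a single matrix describes it.\<close>
  have "\<exists>A\<in>\<Gamma>. \<forall>e\<in>E. f (\<alpha>' g e) = torus_action A (f e)" if g: "g \<in> carrier G'" for g
  proof -
    have "Ck_map 1 torus torus (f \<circ> \<alpha>' g \<circ> k)"
      by (intro Ck_map_1_compose[where Y = X'] smooth_manifold_torus X' f1 k1 a1 g)
    moreover have "\<exists>A\<in>\<Gamma>. (f \<circ> \<alpha>' g \<circ> k) (torus_proj x) = torus_proj (map_matrix real_of_int A *v x)"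
      for x
    proof -
      let ?e = "k (torus_proj x)"
      have e: "?e \<in> E" "f ?e = torus_proj x"
        by (simp_all add: k)
      have "\<alpha>' g ?e \<in> E" "\<alpha>' g ?e \<in> orbit G' \<alpha>' ?e"
        using \<alpha>'.element_image[OF g e(1) refl] g by (auto simp: orbit_def)
      then obtain A where "A \<in> \<Gamma>" "f (\<alpha>' g ?e) = torus_action A (f ?e)"
        using orbit[OF e(1)] by blast
      then show ?thesis
        using e(2) det by (auto simp: torus_action_proj)
    qed
    ultimately obtain A where A: "A \<in> \<Gamma>"
      "\<And>x. (f \<circ> \<alpha>' g \<circ> k) (torus_proj x) = torus_proj (map_matrix real_of_int A *v x)"
      using torus_C1_orbit_map_integer_matrix by blast
    have "f (\<alpha>' g e) = torus_action A (f e)" if e: "e \<in> E" for e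
    proof -
      obtain x where "f e = torus_proj x"
        using fE[OF e] by blast
      then show ?thesis
        using A kf[OF e] det by (metis comp_apply torus_action_proj)
    qed
    with A(1) show ?thesis by blast
  qed
  then obtain \<theta> where \<theta>: "\<And>g. g \<in> carrier G' \<Longrightarrow> \<theta> g \<in> \<Gamma>"
    "\<And>g e. g \<in> carrier G' \<Longrightarrow> e \<in> E \<Longrightarrow> f (\<alpha>' g e) = torus_action (\<theta> g) (f e)"
    by metis
  obtain x :: "real ^ 'n" where free: "\<And>A B. torus_proj (map_matrix real_of_int A *v x)
      = torus_proj (map_matrix real_of_int B *v x) \<Longrightarrow> A = (B :: int ^ 'n ^ 'n)"
    using exists_torus_point_free by metis
  \<comment> \<open>The point of \<open>X'\<close> over the free point. By \<open>eq\<close>,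
    elements of \<open>\<Gamma>\<close> can be compared by their effect on \<open>f e0\<close>
    alone.\<close>
  define e0 where "e0 = k (torus_proj x)"
  have e0: "e0 \<in> E" "f e0 = torus_proj x"
    by (simp_all add: e0_def k)
  have eq: "A = B" if "A \<in> \<Gamma>" "B \<in> \<Gamma>" "torus_action A (f e0) = torus_action B (f e0)" for A B
    using that free det by (simp add: e0 torus_action_proj)
  have "\<theta> \<in> iso G' ?G"
  proof (rule isoI)
    interpret G': group G'
      using \<alpha>'.group_hom group_hom.axioms(1) by blast
    show "\<theta> \<in> hom G' ?G"
    proof (rule homI)
      fix g h assume gh: "g \<in> carrier G'" "h \<in> carrier G'"
      have h0: "\<alpha>' h e0 \<in> E"
        using \<alpha>'.element_image[OF gh(2) e0(1) refl] .
      \<comment> \<open>The values of \<open>\<theta>\<close> were merely chosen, so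
        multiplicativity must be proved: both candidates for the product move \<open>f e0\<close> to
        the same point.\<close>
      have "torus_action (\<theta> (g \<otimes>\<^bsub>G'\<^esub> h)) (f e0) = f (\<alpha>' g (\<alpha>' h e0))"
        using \<theta>(2)[of "g \<otimes>\<^bsub>G'\<^esub> h" e0] gh e0(1) \<alpha>'.composition_rule[of e0 g h] by simp
      also have "\<dots> = torus_action (\<theta> g ** \<theta> h) (f e0)"
        using \<theta> gh e0(1) h0 det fE by (simp add: torus_action_mult)
      finally show "\<theta> (g \<otimes>\<^bsub>G'\<^esub> h) = \<theta> g \<otimes>\<^bsub>?G\<^esub> \<theta> h"
        using eq[of "\<theta> (g \<otimes>\<^bsub>G'\<^esub> h)" "\<theta> g ** \<theta> h"] \<theta>(1) gh
          subgroup.m_closed[OF assms(1), of "\<theta> g" "\<theta> h"] by (simp add: SL_int_def)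
    qed (use \<theta>(1) in simp)
    show "bij_betw \<theta> (carrier G') (carrier ?G)"
      unfolding bij_betw_def
    proof
      show "inj_on \<theta> (carrier G')"
      proof (rule inj_onI)
        fix g h assume gh: "g \<in> carrier G'" "h \<in> carrier G'" "\<theta> g = \<theta> h"
        have "\<alpha>' g e = \<alpha>' h e" if e: "e \<in> E" for e
        proof -
          have "f (\<alpha>' g e) = f (\<alpha>' h e)"
            using \<theta>(2) gh e by simp
          then show ?thesis
            using kf \<alpha>'.element_image[OF gh(1) e refl] \<alpha>'.element_image[OF gh(2) e refl] by metis
        qed
        \<comment> \<open>Agreement on \<open>E\<close> gives equality of functions only together
          with extensionality; faithfulness then applies.\<close>
        moreover have "\<alpha>' g \<in> extensional E" "\<alpha>' h \<in> extensional E"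
          using \<alpha>'.bij_prop0 gh Bij_imp_extensional by blast+
        ultimately have "\<alpha>' g = \<alpha>' h"
          by (metis extensionalityI)
        then show "g = h"
          using \<alpha>'.faithful gh by (simp add: inj_on_def)
      qed
      \<comment> \<open>The image of \<open>f e0\<close> under \<open>A\<close> stays in its orbit,
        so some \<open>g\<close> moves \<open>e0\<close> to the corresponding point of
        \<open>X'\<close>. Then \<open>\<theta> g\<close> and \<open>A\<close> agree at the free
        point and are equal.\<close>
      have "A \<in> \<theta> ` carrier G'" if A: "A \<in> \<Gamma>" for A
      proof -
        have T: "torus_action A (f e0) \<in> ?T"
          using A det e0(1) fE torus_action_closed by blast
        then have "k (torus_action A (f e0)) \<in> orbit G' \<alpha>' e0"
          using orbit[OF e0(1), of "k (torus_action A (f e0))"] k[OF T] A by auto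
        then obtain g where g: "g \<in> carrier G'" "k (torus_action A (f e0)) = \<alpha>' g e0"
          by (auto simp: orbit_def)
        then have "torus_action A (f e0) = torus_action (\<theta> g) (f e0)"
          using \<theta>(2) e0(1) k(2)[OF T] by metis
        then show ?thesis
          using eq[of A "\<theta> g"] A \<theta>(1) g(1) by blast
      qed
      then show "\<theta> ` carrier G' = carrier ?G"
        using \<theta>(1) by auto
    qed
  qed
  then show "equivariant (topspace (mtop X')) G' \<alpha>' ?G torus_action f"
    using \<theta>(2) unfolding equivariant_def E_def by blast
qed

end
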